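(* Let $r_0=\sqrt{5}-2\approx 0.236068$ and $p=2(\sqrt{5}-1)$. Suppose that $f(z) = \sum_{k=0}^\infty a_k z^k$ is analytic in $\mathbb{D}$ and $|f(z)| \leq 1$ for all $z\in\mathbb{D}$. Then $$|f(z)| + \sum_{k=1}^\infty |a_k| r^k + p\left(\frac{S_r}{\pi}\right) \leq 1 \quad\text{whenever } |z| =r \leq r_0.$$ Moreover, the constants $r_0=\sqrt{5}-2$ and $p=2(\sqrt{5}-1)$ are sharp; that is, the assertion (for all such $f$) fails if $r_0$ is replaced by any larger number (with $p$ kept), and it fails if $p$ is replaced by any larger number (with $r_0$ kept).
   Context: $\mathbb{D}=\{z\in\mathbb{C}: |z|<1\}$ is the open unit disk. For $f(z)=\sum_{k=0}^\infty a_kz^k$ analytic in $\mathbb{D}$ and $0\le r<1$, $S_r=S_r(f)$ denotes the area of the image of the subdisk $|z|<r$ under $f$, counted with multiplicity, i.e. $\dfrac{S_r}{\pi}=\sum_{k=1}^\infty k|a_k|^2r^{2k}$. *)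

theory Defs
  imports "HOL-Complex_Analysis.Complex_Analysis"
begin

definition taylor_coeff :: "(complex \<Rightarrow> complex) \<Rightarrow> nat \<Rightarrow> complex" where
  "taylor_coeff f k = fps_nth (fps_expansion f 0) k"

(* Area of the image of the disk of radius r about 0 under f, counted with
   multiplicity, given by its power series; meaningful for f holomorphic on the
   unit disk and 0 \<le> r < 1. The k = 0 term vanishes. *)
definition image_area :: "(complex \<Rightarrow> complex) \<Rightarrow> real \<Rightarrow> real" where
  "image_area f r = pi * (\<Sum>k. real k * (norm (taylor_coeff f k))\<^sup>2 * r ^ (2 * k))"

(* The assertion with radius R and constant q in place of the sharp values.
   The restriction to the unit disk is automatic for R < 1; for larger R it
   keeps every term defined. *)
definition bohr_area_inequality :: "real \<Rightarrow> real \<Rightarrow> bool" where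
  "bohr_area_inequality R q \<longleftrightarrow>
     (\<forall>f. f holomorphic_on ball 0 1 \<and> (\<forall>z\<in>ball 0 1. norm (f z) \<le> 1) \<longrightarrow>
        (\<forall>z\<in>ball 0 1. \<forall>r. norm z = r \<and> r \<le> R \<longrightarrow>
           norm (f z) + (\<Sum>k. norm (taylor_coeff f (Suc k)) * r ^ Suc k)
             + q * (image_area f r / pi) \<le> 1))"

end

theory Submission
  imports Defs
begin

text \<open>
  Write \<open>a = \<bar>a\<^sub>0\<bar>\<close>. Three estimates suffice. Schwarz--Pick gives \<open>\<bar>f z\<bar> \<le> (a + r) / (1 + a r)\<close>;
  combined with Bessel's inequality on circles and Cauchy--Schwarz it also gives
  \<open>\<Sum> \<bar>a\<^sub>k\<bar> r\<^sup>k \<le> r (1 - a\<^sup>2) / (1 - r a)\<close> for \<open>a > r\<close>. The bound \<open>\<bar>a\<^sub>k\<bar> \<le> 1 - a\<^sup>2\<close> gives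
  \<open>S\<^sub>r / \<pi> \<le> (1 - a\<^sup>2)\<^sup>2 r\<^sup>2 / (1 - r\<^sup>2)\<^sup>2\<close>, which is cruder than the best possible bound but agrees
  with it to leading order as \<open>a\<close> tends to 1. By monotonicity only \<open>r = r\<^sub>0\<close> matters, the
  positive root of \<open>r\<^sup>2 + 4 r = 1\<close>: it makes the total at most 1 to first order in \<open>1 - a\<close>, and
  \<open>p = 2 (1 + r\<^sub>0)\<close> does so to second order. Sharpness is read off \<open>(a + z) / (1 + a z)\<close> at \<open>z = r\<close> as
  \<open>a\<close> tends to 1.
\<close>

section \<open>Mean values and Bessel's inequality on circles\<close>

text \<open>Cauchy's integral formula at the centre, written in the angle. Every application has
  \<open>F 0 = 0\<close>, which makes the cross term of a squared modulus integrate to zero.\<close>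

lemma circle_mean_value:
  assumes "F holomorphic_on ball 0 1" "0 < \<rho>" "\<rho> < 1"
  shows "((\<lambda>t. F (of_real \<rho> * cis t)) has_integral 2 * of_real pi * F 0) {0..2*pi}"
proof -
  have "((\<lambda>u. F u / (u - 0)) has_contour_integral (2 * of_real pi * \<i> * F 0)) (circlepath 0 \<rho>)"
    using assms by (intro Cauchy_integral_circlepath_simple holomorphic_on_subset[OF assms(1)]) auto
  hence "((\<lambda>t. F (of_real \<rho> * cis t) / (of_real \<rho> * cis t) * \<rho> * \<i> * cis t) has_integral
      2 * of_real pi * \<i> * F 0) {0..2*pi}"
    unfolding circlepath_def
    by (subst (asm) has_contour_integral_part_circlepath_iff) (auto simp: ac_simps)
  hence "((\<lambda>t. \<i> * F (of_real \<rho> * cis t)) has_integral 2 * of_real pi * \<i> * F 0) {0..2*pi}"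
    by (rule has_integral_cong[THEN iffD1, rotated]) (use assms in \<open>auto simp: field_simps\<close>)
  from has_integral_mult_right[OF this, of "-\<i>"] show ?thesis
    by (simp add: algebra_simps)
qed

lemma holomorphic_on_circle_integrable:
  assumes "F holomorphic_on ball 0 1" "0 < \<rho>" "\<rho> < 1"
  shows "(\<lambda>t. (norm (F (of_real \<rho> * cis t)))\<^sup>2) integrable_on {0..2*pi}"
proof (rule integrable_continuous_real)
  have "continuous_on {0..2*pi} (F \<circ> (\<lambda>t. of_real \<rho> * cis t))"
    by (intro continuous_on_compose continuous_intros
          continuous_on_subset[OF holomorphic_on_imp_continuous_on[OF assms(1)]])
       (use assms in \<open>auto simp: norm_mult\<close>)
  thus "continuous_on {0..2*pi} (\<lambda>t. (norm (F (of_real \<rho> * cis t)))\<^sup>2)"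
    by (auto intro!: continuous_intros simp: o_def)
qed

lemma power_series_holomorphic_unit:
  fixes F :: "complex \<Rightarrow> complex"
  assumes "\<And>z. norm z < 1 \<Longrightarrow> (\<lambda>k. c k * z ^ k) sums F z"
  shows "F holomorphic_on ball 0 1"
  by (rule power_series_holomorphic[of _ _ c]) (use assms in auto)

text \<open>Induction peels off one coefficient: \<open>F z = c 0 + z * G z\<close>, and the cross
  term of the squared modulus has mean zero. Partial sums avoid interchanging a series with the
  integral.\<close>

lemma bessel_circle:
  fixes F :: "complex \<Rightarrow> complex"
  assumes "\<And>z. norm z < 1 \<Longrightarrow> (\<lambda>k. c k * z ^ k) sums F z" "0 < \<rho>" "\<rho> < 1"
  shows "2 * pi * (\<Sum>k<n. (norm (c k))\<^sup>2 * (\<rho>\<^sup>2) ^ k)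
           \<le> integral {0..2*pi} (\<lambda>t. (norm (F (of_real \<rho> * cis t)))\<^sup>2)"
  using assms(1)
proof (induction n arbitrary: c F)
  case 0
  show ?case
    using holomorphic_on_circle_integrable[OF power_series_holomorphic_unit[OF 0] assms(2,3)]
    by (auto intro!: integral_nonneg)
next
  case (Suc n)
  \<comment> \<open>The value \<open>c 1\<close> fills the removable singularity, so
    \<open>G\<close> has the shifted coefficients and the induction hypothesis applies to
    it.\<close>
  define G where "G z = (if z = 0 then c 1 else (F z - c 0) / z)" for z
  have F0: "F 0 = c 0"
    using sums_unique2[OF Suc.prems[of 0]] powser_sums_zero by auto
  have G: "(\<lambda>k. c (Suc k) * z ^ k) sums G z" if "norm z < 1" for z
  proof (cases "z = 0")
    case True
    thus ?thesis using powser_sums_zero[of "\<lambda>k. c (Suc k)"] by (simp add: G_def)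
  next
    case False
    have "(\<lambda>k. c (Suc k) * z ^ Suc k) sums (F z - c 0)"
      using sums_Suc_iff[of "\<lambda>k. c k * z ^ k"] Suc.prems[OF that] by simp
    from sums_divide[OF this, of z] show ?thesis
      using False by (simp add: G_def)
  qed
  have FG: "F z = c 0 + z * G z" for z
    using F0 by (auto simp: G_def)
  have holG: "G holomorphic_on ball 0 1"
    by (rule power_series_holomorphic_unit) (rule G)
  let ?z = "\<lambda>t. of_real \<rho> * cis t :: complex"
  have IG: "((\<lambda>t. (norm (G (?z t)))\<^sup>2) has_integral
      integral {0..2*pi} (\<lambda>t. (norm (G (?z t)))\<^sup>2)) {0..2*pi}" (is "(_ has_integral ?I) _")
    using holomorphic_on_circle_integrable[OF holG assms(2,3)] by blast
  have "((\<lambda>t. cnj (c 0) * (?z t * G (?z t))) has_integral 2 * of_real pi * (cnj (c 0) * (0 * G 0))) {0..2*pi}"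
    by (rule circle_mean_value[of "\<lambda>z. cnj (c 0) * (z * G z)"])
       (intro holomorphic_intros holG assms)+
  from has_integral_Re[OF this]
  have M: "((\<lambda>t. Re (cnj (c 0) * (?z t * G (?z t)))) has_integral 0) {0..2*pi}"
    by simp
  have eq: "(norm (F (?z t)))\<^sup>2 = (norm (c 0))\<^sup>2 + 2 * Re (cnj (c 0) * (?z t * G (?z t)))
       + \<rho>\<^sup>2 * (norm (G (?z t)))\<^sup>2" for t
  proof -
    have "(norm (u + v))\<^sup>2 = (norm u)\<^sup>2 + 2 * Re (cnj u * v) + (norm v)\<^sup>2" for u v
      unfolding cmod_power2 by (simp add: algebra_simps power2_eq_square)
    from this[of "c 0" "?z t * G (?z t)"] show ?thesis
      unfolding FG by (simp add: norm_mult power_mult_distrib)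
  qed
  have "((\<lambda>t. (norm (F (?z t)))\<^sup>2) has_integral
      (2 * pi * (norm (c 0))\<^sup>2 + 2 * 0 + \<rho>\<^sup>2 * ?I)) {0..2*pi}"
    unfolding eq
    by (intro has_integral_add has_integral_mult_right M IG)
       (use has_integral_const_real[of "(norm (c 0))\<^sup>2" 0 "2*pi"] in simp)
  hence "integral {0..2*pi} (\<lambda>t. (norm (F (?z t)))\<^sup>2) = 2 * pi * (norm (c 0))\<^sup>2 + \<rho>\<^sup>2 * ?I"
    by (simp add: integral_unique)
  moreover have "\<rho>\<^sup>2 * (2 * pi * (\<Sum>k<n. (norm (c (Suc k)))\<^sup>2 * (\<rho>\<^sup>2) ^ k)) \<le> \<rho>\<^sup>2 * ?I"
    by (intro mult_left_mono Suc.IH G) auto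
  ultimately show ?case
    by (subst sum.lessThan_Suc_shift)
       (simp add: algebra_simps sum_distrib_left sum_distrib_right)
qed

text \<open>Bessel's inequality for \<open>(1 + \<beta> z\<^sup>n) f\<close>, whose \<open>n\<close>-th coefficient is
  \<open>c\<^sub>n + \<beta> c\<^sub>0\<close>; the choice of \<open>\<beta>\<close> below is the optimal one.\<close>

lemma bounded_coeff_le:
  fixes F :: "complex \<Rightarrow> complex"
  assumes F: "\<And>z. norm z < 1 \<Longrightarrow> (\<lambda>k. c k * z ^ k) sums F z"
    and bd: "\<And>z. norm z < 1 \<Longrightarrow> norm (F z) \<le> 1" and "n > 0"
  shows "norm (c n) \<le> 1 - (norm (c 0))\<^sup>2"
proof -
  have key: "(norm (c 0))\<^sup>2 + (norm (c n + \<beta> * c 0))\<^sup>2 \<le> 1 + (norm \<beta>)\<^sup>2" for \<beta>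
  proof -
    define d where "d k = c k + (if k < n then 0 else \<beta> * c (k - n))" for k
    have d: "(\<lambda>k. d k * z ^ k) sums ((1 + \<beta> * z ^ n) * F z)" if "norm z < 1" for z
    proof -
      have "(\<lambda>k. \<beta> * z ^ n * (c k * z ^ k)) sums (\<beta> * z ^ n * F z)"
        by (intro sums_mult F that)
      also have "(\<lambda>k. \<beta> * z ^ n * (c k * z ^ k)) =
          (\<lambda>k. (if k + n < n then 0 else \<beta> * c (k + n - n)) * z ^ (k + n))"
        by (auto simp: power_add)
      finally have "(\<lambda>k. (if k < n then 0 else \<beta> * c (k - n)) * z ^ k) sums (\<beta> * z ^ n * F z)"
        by (subst (asm) sums_iff_shift) simp
      from sums_add[OF F[OF that] this] show ?thesis
        by (simp add: d_def algebra_simps)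
    qed
    have bound: "(norm (c 0))\<^sup>2 + (norm (c n + \<beta> * c 0))\<^sup>2 * (\<rho>\<^sup>2) ^ n \<le> 1 + (norm \<beta>)\<^sup>2"
      if \<rho>: "0 < \<rho>" "\<rho> < 1" for \<rho>
    proof -
      let ?z = "\<lambda>t. of_real \<rho> * cis t :: complex"
      have "((\<lambda>t. \<beta> * ?z t ^ n) has_integral 2 * of_real pi * (\<beta> * 0 ^ n)) {0..2*pi}"
        by (rule circle_mean_value[of "\<lambda>z. \<beta> * z ^ n"]) (intro holomorphic_intros \<rho>)+
      from has_integral_Re[OF this]
      have M: "((\<lambda>t. Re (\<beta> * ?z t ^ n)) has_integral 0) {0..2*pi}"
        using \<open>n > 0\<close> by (simp add: zero_power)
      have M': "((\<lambda>t. (1 + (norm \<beta>)\<^sup>2) + 2 * Re (\<beta> * ?z t ^ n)) has_integral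
          (2 * pi * (1 + (norm \<beta>)\<^sup>2) + 2 * 0)) {0..2*pi}"
        by (intro has_integral_add has_integral_mult_right M)
           (use has_integral_const_real[of "1 + (norm \<beta>)\<^sup>2" 0 "2*pi"] in simp)
      have "2 * pi * (\<Sum>k<Suc n. (norm (d k))\<^sup>2 * (\<rho>\<^sup>2) ^ k)
           \<le> integral {0..2*pi} (\<lambda>t. (norm ((1 + \<beta> * ?z t ^ n) * F (?z t)))\<^sup>2)"
        by (rule bessel_circle[OF d \<rho>])
      also have "\<dots> \<le> 2 * pi * (1 + (norm \<beta>)\<^sup>2) + 2 * 0"
      proof (rule has_integral_le[OF _ M'])
        show "((\<lambda>t. (norm ((1 + \<beta> * ?z t ^ n) * F (?z t)))\<^sup>2) has_integral
            integral {0..2*pi} (\<lambda>t. (norm ((1 + \<beta> * ?z t ^ n) * F (?z t)))\<^sup>2)) {0..2*pi}"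
          using holomorphic_on_circle_integrable[OF power_series_holomorphic_unit[OF d] \<rho>] by blast
      next
        fix t
        have z: "norm (?z t) < 1" "norm (?z t ^ n) \<le> 1"
          using \<rho> by (auto simp: norm_mult norm_power power_le_one)
        have "norm ((1 + \<beta> * ?z t ^ n) * F (?z t)) \<le> norm (1 + \<beta> * ?z t ^ n)"
          using bd[OF z(1)] by (simp add: norm_mult mult_left_le)
        hence "(norm ((1 + \<beta> * ?z t ^ n) * F (?z t)))\<^sup>2 \<le> (norm (1 + \<beta> * ?z t ^ n))\<^sup>2"
          by (intro power_mono) auto
        also have "\<dots> = 1 + (norm (\<beta> * ?z t ^ n))\<^sup>2 + 2 * Re (\<beta> * ?z t ^ n)"
          unfolding cmod_power2 by (simp add: algebra_simps power2_eq_square)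
        also have "(norm (\<beta> * ?z t ^ n))\<^sup>2 \<le> (norm \<beta>)\<^sup>2"
          using z(2) by (intro power_mono) (simp_all add: norm_mult mult_left_le)
        finally show "(norm ((1 + \<beta> * ?z t ^ n) * F (?z t)))\<^sup>2
            \<le> (1 + (norm \<beta>)\<^sup>2) + 2 * Re (\<beta> * ?z t ^ n)" by simp
      qed
      finally have "(\<Sum>k<Suc n. (norm (d k))\<^sup>2 * (\<rho>\<^sup>2) ^ k) \<le> 1 + (norm \<beta>)\<^sup>2"
        by simp
      \<comment> \<open>Only the coefficients at 0 and \<open>n\<close> are kept;
        \<open>d 0 = c 0\<close> because \<open>n > 0\<close>.\<close>
      moreover have "(\<Sum>k\<in>{0,n}. (norm (d k))\<^sup>2 * (\<rho>\<^sup>2) ^ k) \<le> (\<Sum>k<Suc n. (norm (d k))\<^sup>2 * (\<rho>\<^sup>2) ^ k)"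
        by (intro sum_mono2) auto
      ultimately show ?thesis using \<open>n > 0\<close> by (simp add: d_def)
    qed
    \<comment> \<open>The weight at index \<open>n\<close> is removed by letting the radius tend to
      1 from the left.\<close>
    have "((\<lambda>\<rho>. (norm (c 0))\<^sup>2 + (norm (c n + \<beta> * c 0))\<^sup>2 * (\<rho>\<^sup>2) ^ n) \<longlongrightarrow>
        (norm (c 0))\<^sup>2 + (norm (c n + \<beta> * c 0))\<^sup>2 * (1\<^sup>2) ^ n) (at_left (1::real))"
      by (intro tendsto_intros)
    moreover have "\<forall>\<^sub>F \<rho> in at_left 1. (norm (c 0))\<^sup>2 + (norm (c n + \<beta> * c 0))\<^sup>2 * (\<rho>\<^sup>2) ^ n \<le> 1 + (norm \<beta>)\<^sup>2"
      by (rule eventually_mono[OF eventually_at_left_real[of 0 1]]) (use bound in auto)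
    ultimately show ?thesis
      using tendsto_upperbound[of _ _ "at_left (1::real)"] by fastforce
  qed
  define A where "A = 1 - (norm (c 0))\<^sup>2"
  have "c 0 = F 0"
    using sums_unique2[OF F[of 0]] powser_sums_zero by auto
  hence A0: "A \<ge> 0"
    using bd[of 0] by (simp add: A_def power_le_one)
  show ?thesis
  proof (cases "A = 0")
    case True
    \<comment> \<open>Here \<beta> = 0 already forces \<open>c n = 0\<close>; the general choice
      would divide by \<open>A\<close>.\<close>
    thus ?thesis using key[of 0] by (simp add: A_def)
  next
    case False
    \<comment> \<open>As \<open>A + c 0 * cnj (c 0) = 1\<close>, this choice turns
      \<open>c n + \<beta> * c 0\<close> into \<open>c n / A\<close>, and \<open>key\<close> reduces
      to a bound on \<open>norm (c n) / A\<close> alone.\<close>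
    define \<beta> where "\<beta> = cnj (c 0) * c n / of_real A"
    have "of_real A * (c n + \<beta> * c 0) = c n * (of_real A + c 0 * cnj (c 0))"
      using False by (simp add: \<beta>_def field_simps)
    also have "of_real A + c 0 * cnj (c 0) = 1"
      by (simp add: A_def complex_norm_square[symmetric])
    finally have "c n + \<beta> * c 0 = c n / of_real A"
      using False by (simp add: field_simps)
    hence "norm (c n + \<beta> * c 0) = norm (c n) / A" "norm \<beta> = norm (c 0) * norm (c n) / A"
      using A0 by (simp_all add: \<beta>_def norm_mult norm_divide)
    with key[of \<beta>] have "1 - A + (norm (c n) / A)\<^sup>2 \<le> 1 + (norm (c 0) * norm (c n) / A)\<^sup>2"
      by (simp add: A_def)
    hence "(1 - (norm (c 0))\<^sup>2) * (norm (c n) / A)\<^sup>2 \<le> A"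
      unfolding times_divide_eq_right[symmetric] power_mult_distrib left_diff_distrib by simp
    hence "A * (norm (c n) / A)\<^sup>2 \<le> A * 1" by (simp add: A_def)
    hence "(norm (c n) / A)\<^sup>2 \<le> 1"
      using A0 False by (subst (asm) mult_le_cancel_left_pos) auto
    hence "norm (c n) / A \<le> 1"
      using power_le_one_iff[of "norm (c n) / A" 2] A0 by auto
    thus ?thesis using A0 False by (simp add: A_def[symmetric] field_simps)
  qed
qed

section \<open>Schwarz-Pick estimates\<close>

text \<open>This identity is why the Moebius map sending \<open>w\<close> to
  \<open>(w - a) / (1 - cnj a * w)\<close> preserves the disk when \<open>a\<close> lies in
  it.\<close>

lemma norm_one_minus_cnj_mult:
  "(norm (1 - cnj a * w))\<^sup>2 - (norm (w - a))\<^sup>2 = (1 - (norm a)\<^sup>2) * (1 - (norm w)\<^sup>2)"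
  unfolding cmod_power2 by (simp add: algebra_simps power2_eq_square)

text \<open>Schwarz's lemma for \<open>f\<close> followed by the disk automorphism that moves
  \<open>f 0\<close> to 0. The form without denominators also covers unimodular constants.\<close>

lemma schwarz_pick_0:
  assumes holf: "f holomorphic_on ball 0 1" and bd: "\<And>z. norm z < 1 \<Longrightarrow> norm (f z) \<le> 1"
    and z: "norm z < 1"
  shows "norm (f z - f 0) \<le> norm z * norm (1 - cnj (f 0) * f z)"
proof (cases "norm (f 0) = 1")
  case True
  have "f constant_on ball 0 1"
    by (rule maximum_modulus_principle[of _ _ "ball 0 1" 0]) (use bd True holf in auto)
  hence "f z = f 0" using z by (auto simp: constant_on_def)
  thus ?thesis by simp
next
  case False
  with bd[of 0] have a: "norm (f 0) < 1" by simp
  have ne: "1 - cnj (f 0) * f w \<noteq> 0" if "norm w < 1" for w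
  proof -
    have "norm (cnj (f 0) * f w) \<le> norm (f 0) * 1"
      unfolding norm_mult by (intro mult_mono) (use bd[OF that] in auto)
    thus ?thesis using a by auto
  qed
  define g where "g w = (f w - f 0) / (1 - cnj (f 0) * f w)" for w
  have holg: "g holomorphic_on ball 0 1"
    unfolding g_def by (intro holomorphic_intros holf) (use ne in auto)
  have g0: "g 0 = 0" by (simp add: g_def)
  have le: "norm (g w) \<le> 1" if w: "norm w < 1" for w
  proof -
    have "0 \<le> (1 - (norm (f 0))\<^sup>2) * (1 - (norm (f w))\<^sup>2)"
      using a bd[OF w] by (intro mult_nonneg_nonneg) (auto simp: power_le_one)
    hence "(norm (f w - f 0))\<^sup>2 \<le> (norm (1 - cnj (f 0) * f w))\<^sup>2"
      using norm_one_minus_cnj_mult[of "f 0" "f w"] by linarith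
    hence "norm (f w - f 0) \<le> norm (1 - cnj (f 0) * f w)"
      by (rule power2_le_imp_le) simp
    thus ?thesis
      using ne[OF w] by (simp add: g_def norm_divide)
  qed
  \<comment> \<open>Schwarz's lemma is applied with a strict bound; a point of modulus 1 would make
    \<open>g\<close> constant, hence equal to \<open>g 0 = 0\<close>.\<close>
  have less: "norm (g w) < 1" if w: "norm w < 1" for w
  proof (rule ccontr)
    assume "\<not> norm (g w) < 1"
    with le[OF w] have "norm (g w) = 1" by simp
    hence "g constant_on ball 0 1"
      by (intro maximum_modulus_principle[of _ _ "ball 0 1" w]) (use le w holg in auto)
    hence "g w = g 0" using w by (auto simp: constant_on_def)
    thus False using \<open>norm (g w) = 1\<close> g0 by simp
  qed
  have "norm (g z) \<le> norm z"
    by (rule Schwarz_Lemma(1)[OF holg g0 less z])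
  thus ?thesis
    using ne[OF z] by (simp add: g_def norm_divide divide_le_eq)
qed

text \<open>The identity \<open>norm_one_minus_cnj_mult\<close> makes the bound depend on
  \<open>f z\<close> only through \<open>x\<close> and \<open>?N\<close>. Replacing
  \<open>?N\<close> by the smaller \<open>1 - a * x\<close> and using the identity for real numbers
  leads back to \<open>x - a \<le> r * (1 - a * x)\<close>.\<close>

lemma schwarz_pick_norm:
  assumes holf: "f holomorphic_on ball 0 1" and bd: "\<And>z. norm z < 1 \<Longrightarrow> norm (f z) \<le> 1"
    and z: "norm z < 1"
  shows "norm (f z) \<le> (norm (f 0) + norm z) / (1 + norm (f 0) * norm z)"
proof -
  define a x r where "a = norm (f 0)" and "x = norm (f z)" and "r = norm z"
  have ranges: "0 \<le> a" "a \<le> 1" "0 \<le> x" "x \<le> 1" "0 \<le> r" "r < 1"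
    using bd[of 0] bd[OF z] z by (auto simp: a_def x_def r_def)
  let ?N = "norm (1 - cnj (f 0) * f z)"
  have "(norm (f z - f 0))\<^sup>2 \<le> (r * ?N)\<^sup>2"
    using schwarz_pick_0[OF assms] by (intro power_mono) (auto simp: r_def)
  hence "(1 - r\<^sup>2) * ?N\<^sup>2 \<le> (1 - a\<^sup>2) * (1 - x\<^sup>2)"
    using norm_one_minus_cnj_mult[of "f 0" "f z"]
    by (simp add: a_def x_def power_mult_distrib algebra_simps)
  moreover have "(1 - r\<^sup>2) * (1 - a * x)\<^sup>2 \<le> (1 - r\<^sup>2) * ?N\<^sup>2"
  proof (intro mult_left_mono power_mono)
    show "1 - a * x \<le> ?N"
      using norm_triangle_ineq2[of 1 "cnj (f 0) * f z"] by (simp add: norm_mult a_def x_def)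
    show "0 \<le> 1 - a * x" using ranges by (simp add: mult_le_one)
    show "0 \<le> 1 - r\<^sup>2" using ranges by (simp add: power_le_one)
  qed
  ultimately have "(x - a)\<^sup>2 \<le> (r * (1 - a * x))\<^sup>2"
    by (simp add: power2_eq_square algebra_simps)
  hence "x - a \<le> r * (1 - a * x)"
    by (rule power2_le_imp_le) (use ranges in \<open>simp add: mult_le_one\<close>)
  hence "x * (1 + a * r) \<le> a + r" by (simp add: algebra_simps)
  thus ?thesis
    using ranges unfolding a_def[symmetric] x_def[symmetric] r_def[symmetric]
    by (subst pos_le_divide_eq) (auto intro: add_pos_nonneg)
qed

text \<open>By Schwarz--Pick, \<open>H = F - c\<^sub>0\<close> satisfies \<open>\<bar>H\<bar> \<le> \<bar>z\<bar> \<bar>(1 - \<bar>c\<^sub>0\<bar>\<^sup>2) - \<bar>c\<^sub>0\<bar> u H\<bar>\<close> with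
  \<open>\<bar>u\<bar> = 1\<close>; as \<open>H\<close> has mean zero on circles, the cross term vanishes after integration.\<close>

lemma bounded_coeff_square_sum:
  fixes F :: "complex \<Rightarrow> complex"
  assumes F: "\<And>z. norm z < 1 \<Longrightarrow> (\<lambda>k. c k * z ^ k) sums F z"
    and bd: "\<And>z. norm z < 1 \<Longrightarrow> norm (F z) \<le> 1" and t: "0 < t" "t < 1"
  shows "(1 - (norm (c 0))\<^sup>2 * t) * (\<Sum>k<n. (norm (c (Suc k)))\<^sup>2 * t ^ Suc k)
           \<le> t * (1 - (norm (c 0))\<^sup>2)\<^sup>2"
proof -
  \<comment> \<open>The square root makes Bessel's weights \<open>(\<rho>\<^sup>2) ^ k\<close> equal
    to \<open>t ^ k\<close>.\<close>
  define a \<rho> where "a = norm (c 0)" and "\<rho> = sqrt t"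
  have \<rho>: "0 < \<rho>" "\<rho> < 1" "\<rho>\<^sup>2 = t" using t by (auto simp: \<rho>_def)
  define H where "H z = F z - c 0" for z
  define d where "d k = (if k = 0 then 0 else c k)" for k
  have F0: "F 0 = c 0"
    using sums_unique2[OF F[of 0]] powser_sums_zero by auto
  hence H0: "H 0 = 0" by (simp add: H_def)
  have a1: "a \<le> 1" "a \<ge> 0" using bd[of 0] F0 by (auto simp: a_def)
  have holF: "F holomorphic_on ball 0 1"
    by (rule power_series_holomorphic_unit) (rule F)
  have H: "(\<lambda>k. d k * z ^ k) sums H z" if "norm z < 1" for z
  proof -
    have "(\<lambda>k. d (Suc k) * z ^ Suc k) sums H z"
      using F[OF that] sums_Suc_iff[of "\<lambda>k. c k * z ^ k"] by (simp add: d_def H_def)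
    thus ?thesis using sums_Suc_iff[of "\<lambda>k. d k * z ^ k"] by (simp add: d_def)
  qed
  have holH: "H holomorphic_on ball 0 1"
    by (rule power_series_holomorphic_unit) (rule H)
  let ?z = "\<lambda>s. of_real \<rho> * cis s :: complex"
  let ?I = "integral {0..2*pi} (\<lambda>s. (norm (H (?z s)))\<^sup>2)"
  have IH: "((\<lambda>s. (norm (H (?z s)))\<^sup>2) has_integral ?I) {0..2*pi}"
    using holomorphic_on_circle_integrable[OF holH \<rho>(1,2)] by blast
  have "((\<lambda>s. cnj (c 0) * H (?z s)) has_integral 2 * of_real pi * (cnj (c 0) * H 0)) {0..2*pi}"
    by (rule circle_mean_value[of "\<lambda>z. cnj (c 0) * H z"]) (intro holomorphic_intros holH \<rho>)+
  from has_integral_Re[OF this]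
  have M: "((\<lambda>s. Re (cnj (c 0) * H (?z s))) has_integral 0) {0..2*pi}"
    by (simp add: H0)
  have M': "((\<lambda>s. t * (1 - a\<^sup>2)\<^sup>2 + (-2 * t * (1 - a\<^sup>2)) * Re (cnj (c 0) * H (?z s)))
      has_integral 2 * pi * (t * (1 - a\<^sup>2)\<^sup>2) + (-2 * t * (1 - a\<^sup>2)) * 0) {0..2*pi}"
    by (intro has_integral_add has_integral_mult_right M)
       (use has_integral_const_real[of "t * (1 - a\<^sup>2)\<^sup>2" 0 "2*pi"] in simp)
  \<comment> \<open>The factor \<open>1 - a\<^sup>2 * t\<close> comes from moving the last term of
    the expanded Schwarz-Pick square to the left.\<close>
  have IH': "((\<lambda>s. (1 - a\<^sup>2 * t) * (norm (H (?z s)))\<^sup>2) has_integral (1 - a\<^sup>2 * t) * ?I) {0..2*pi}"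
    by (intro has_integral_mult_right IH)
  have "(1 - a\<^sup>2 * t) * ?I \<le> 2 * pi * (t * (1 - a\<^sup>2)\<^sup>2) + (-2 * t * (1 - a\<^sup>2)) * 0"
  proof (rule has_integral_le[OF IH' M'])
    fix s
    have z: "norm (?z s) = \<rho>" using \<rho> by (simp add: norm_mult)
    let ?w = "H (?z s)"
    have eq: "1 - cnj (F 0) * F (?z s) = of_real (1 - a\<^sup>2) - cnj (c 0) * ?w"
      by (simp add: H_def F0 a_def algebra_simps flip: complex_norm_square)
    have "norm ?w \<le> \<rho> * norm (of_real (1 - a\<^sup>2) - cnj (c 0) * ?w)"
      using schwarz_pick_0[OF holF bd, of "?z s"] \<rho>(2) unfolding eq z by (simp only: H_def F0)
    hence "(norm ?w)\<^sup>2 \<le> (\<rho> * norm (of_real (1 - a\<^sup>2) - cnj (c 0) * ?w))\<^sup>2"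
      by (intro power_mono) auto
    also have "\<dots> = t * (norm (of_real (1 - a\<^sup>2) - cnj (c 0) * ?w))\<^sup>2"
      by (simp add: power_mult_distrib \<rho>)
    also have "(norm (of_real (1 - a\<^sup>2) - cnj (c 0) * ?w))\<^sup>2
       = (1 - a\<^sup>2)\<^sup>2 - 2 * (1 - a\<^sup>2) * Re (cnj (c 0) * ?w) + (norm (cnj (c 0) * ?w))\<^sup>2"
    proof -
      have "(norm (of_real u - v))\<^sup>2 = u\<^sup>2 - 2 * u * Re v + (norm v)\<^sup>2" for u v
        unfolding cmod_power2 by (simp add: algebra_simps power2_eq_square)
      thus ?thesis .
    qed
    also have "norm (cnj (c 0) * ?w) = a * norm ?w" by (simp add: norm_mult a_def)
    finally show "(1 - a\<^sup>2 * t) * (norm ?w)\<^sup>2 \<le>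
        t * (1 - a\<^sup>2)\<^sup>2 + (-2 * t * (1 - a\<^sup>2)) * Re (cnj (c 0) * ?w)"
      by (simp add: algebra_simps power_mult_distrib)
  qed
  moreover have "(1 - a\<^sup>2 * t) * (2 * pi * (\<Sum>k<Suc n. (norm (d k))\<^sup>2 * (\<rho>\<^sup>2) ^ k)) \<le> (1 - a\<^sup>2 * t) * ?I"
    using a1 t by (intro mult_left_mono bessel_circle[OF H \<rho>(1,2)])
      (auto intro!: mult_le_one power_le_one)
  ultimately have "2 * pi * ((1 - a\<^sup>2 * t) * (\<Sum>k<Suc n. (norm (d k))\<^sup>2 * t ^ k)) \<le> 2 * pi * (t * (1 - a\<^sup>2)\<^sup>2)"
    unfolding \<rho>(3) by (simp only: mult.left_commute[of "1 - a\<^sup>2 * t"])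
  hence "(1 - a\<^sup>2 * t) * (\<Sum>k<Suc n. (norm (d k))\<^sup>2 * t ^ k) \<le> t * (1 - a\<^sup>2)\<^sup>2"
    by simp
  thus ?thesis
    by (subst (asm) sum.lessThan_Suc_shift) (simp add: d_def a_def)
qed

section \<open>Bounds for the absolute coefficient sum and the area\<close>

text \<open>Comparison with a geometric series. The crude sum bound serves the case where
  \<open>norm (c 0)\<close> is at most \<open>r\<close>, which the sharp estimate excludes.\<close>

lemma bounded_coeff_abs_summable:
  fixes F :: "complex \<Rightarrow> complex"
  assumes F: "\<And>z. norm z < 1 \<Longrightarrow> (\<lambda>k. c k * z ^ k) sums F z"
    and bd: "\<And>z. norm z < 1 \<Longrightarrow> norm (F z) \<le> 1" and r: "0 \<le> r" "r < 1"
  shows "summable (\<lambda>k. norm (c (Suc k)) * r ^ Suc k)"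
    and "(\<Sum>k. norm (c (Suc k)) * r ^ Suc k) \<le> r * (1 - (norm (c 0))\<^sup>2) / (1 - r)"
proof -
  have le: "norm (c (Suc k)) * r ^ Suc k \<le> (1 - (norm (c 0))\<^sup>2) * r * r ^ k" for k
    using mult_right_mono[OF bounded_coeff_le[OF F bd, of "Suc k"], of "r ^ Suc k"] r
    by (simp add: mult_ac)
  have g: "(\<lambda>k. (1 - (norm (c 0))\<^sup>2) * r * r ^ k) sums ((1 - (norm (c 0))\<^sup>2) * r * (1 / (1 - r)))"
    using r by (intro sums_mult geometric_sums) auto
  show s: "summable (\<lambda>k. norm (c (Suc k)) * r ^ Suc k)"
    by (rule summable_comparison_test'[OF sums_summable[OF g], of 0]) (use le r in auto)
  from suminf_le[OF le s sums_summable[OF g]] sums_unique[OF g]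
  show "(\<Sum>k. norm (c (Suc k)) * r ^ Suc k) \<le> r * (1 - (norm (c 0))\<^sup>2) / (1 - r)"
    by (simp add: mult_ac)
qed

text \<open>AM-GM with the weights \<open>t\<^sup>k\<close>, \<open>t = r / a\<close>, for which it is an equality at \<open>(a + z) / (1 + a z)\<close>.\<close>

lemma bounded_coeff_abs_sum_le:
  fixes F :: "complex \<Rightarrow> complex"
  assumes F: "\<And>z. norm z < 1 \<Longrightarrow> (\<lambda>k. c k * z ^ k) sums F z"
    and bd: "\<And>z. norm z < 1 \<Longrightarrow> norm (F z) \<le> 1" and r: "0 < r" "r < norm (c 0)"
  shows "(\<Sum>k. norm (c (Suc k)) * r ^ Suc k) \<le> r * (1 - (norm (c 0))\<^sup>2) / (1 - r * norm (c 0))"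
proof -
  define a where "a = norm (c 0)"
  have F0: "F 0 = c 0"
    using sums_unique2[OF F[of 0]] powser_sums_zero by auto
  have a: "0 < a" "a \<le> 1" "r < a" "r < 1" using bd[of 0] F0 r by (auto simp: a_def)
  show ?thesis
  proof (cases "a = 1")
    case True
    hence "norm (c (Suc k)) = 0" for k
      using bounded_coeff_le[OF F bd, of "Suc k"] by (simp add: a_def)
    thus ?thesis using True by (simp add: a_def)
  next
    case False
    \<comment> \<open>The assumption \<open>r < a\<close> gives \<open>t < 1\<close>. The weight
      \<open>l\<close> balances the AM-GM step: it is an equality when
      \<open>norm (c k) = A * a ^ (k - 1)\<close> for \<open>k \<ge> 1\<close>.\<close>
    define A t l where "A = 1 - a\<^sup>2" and "t = r / a" and "l = a / A"
    have A: "A > 0" using a False by (simp add: A_def power_less_one_iff)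
    have l: "l > 0" using A a by (simp add: l_def)
    have t: "0 < t" "t < 1" using a r by (auto simp: t_def)
    have ra: "0 < r * a" "r * a < 1" 
    proof -
      show "0 < r * a" using a r by simp
      have "r * a \<le> r * 1" using a r by (intro mult_left_mono) auto
      thus "r * a < 1" using a by linarith
    qed
    have amgm: "norm (c k) * r ^ k \<le> (l/2) * ((norm (c k))\<^sup>2 * t ^ k) + (1/(2*l)) * (r * a) ^ k" for k
    proof -
      have "r * r = t * (r * a)" using a by (simp add: t_def)
      hence "r = sqrt t * sqrt (r * a)"
        using r by (metis real_sqrt_mult real_sqrt_abs2 abs_of_pos)
      hence rk: "r ^ k = sqrt t ^ k * sqrt (r * a) ^ k"
        by (metis power_mult_distrib)
      have tk: "t ^ k = (sqrt t ^ k)\<^sup>2" "(r * a) ^ k = (sqrt (r * a) ^ k)\<^sup>2"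
        using t ra by (simp_all flip: power_mult add: mult.commute[of _ 2]) (simp_all add: power_mult)
      have "0 \<le> (l * (norm (c k) * sqrt t ^ k) - sqrt (r * a) ^ k)\<^sup>2" by simp
      thus ?thesis
        unfolding rk tk using l by (simp add: field_simps power2_eq_square)
    qed
    have geo: "(\<Sum>k<n. (r * a) ^ Suc k) \<le> r * a / (1 - r * a)" for n
    proof -
      have "(\<lambda>k. (r * a) * (r * a) ^ k) sums ((r * a) * (1 / (1 - r * a)))"
        using ra by (intro sums_mult geometric_sums) auto
      hence s: "(\<lambda>k. (r * a) ^ Suc k) sums (r * a / (1 - r * a))" by simp
      have "(\<Sum>k<n. (r * a) ^ Suc k) \<le> suminf (\<lambda>k. (r * a) ^ Suc k)"
        using ra by (intro sum_le_suminf sums_summable[OF s]) auto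
      thus ?thesis using sums_unique[OF s] by simp
    qed
    have sq: "(\<Sum>k<n. (norm (c (Suc k)))\<^sup>2 * t ^ Suc k) \<le> t * A\<^sup>2 / (1 - r * a)" for n
    proof -
      \<comment> \<open>Hence the factor in \<open>bounded_coeff_square_sum\<close> is the
        denominator \<open>1 - r * a\<close> of the geometric part.\<close>
      have "a\<^sup>2 * t = r * a" using a by (simp add: t_def power2_eq_square)
      thus ?thesis
        using bounded_coeff_square_sum[OF F bd t, of n] ra
        unfolding a_def[symmetric] A_def[symmetric]
        by (simp add: pos_le_divide_eq mult.commute)
    qed
    have "(\<Sum>k. norm (c (Suc k)) * r ^ Suc k) \<le> A * r / (1 - r * a)"
    proof (rule suminf_le_const)
      show "summable (\<lambda>k. norm (c (Suc k)) * r ^ Suc k)"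
        by (rule bounded_coeff_abs_summable[OF F bd]) (use a r in auto)
      fix n
      have "(\<Sum>k<n. norm (c (Suc k)) * r ^ Suc k) \<le>
          (\<Sum>k<n. (l/2) * ((norm (c (Suc k)))\<^sup>2 * t ^ Suc k) + (1/(2*l)) * (r * a) ^ Suc k)"
        by (intro sum_mono amgm)
      also have "\<dots> = (l/2) * (\<Sum>k<n. (norm (c (Suc k)))\<^sup>2 * t ^ Suc k) + (1/(2*l)) * (\<Sum>k<n. (r * a) ^ Suc k)"
        by (simp only: sum.distrib sum_distrib_left)
      also have "\<dots> \<le> (l/2) * (t * A\<^sup>2 / (1 - r * a)) + (1/(2*l)) * (r * a / (1 - r * a))"
        using l by (intro add_mono mult_left_mono geo sq) auto
      also have "\<dots> = A * r / (1 - r * a)"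
      proof -
        have "(l/2) * (t * A\<^sup>2 / (1 - r * a)) = A * r / (1 - r * a) / 2"
          using a A by (simp add: l_def t_def power2_eq_square mult_ac)
        moreover have "(1/(2*l)) * (r * a / (1 - r * a)) = A * r / (1 - r * a) / 2"
          using a A by (simp add: l_def mult_ac)
        ultimately show ?thesis by (simp only: field_sum_of_halves)
      qed
      finally show "(\<Sum>k<n. norm (c (Suc k)) * r ^ Suc k) \<le> A * r / (1 - r * a)" .
    qed
    thus ?thesis by (simp add: A_def a_def mult_ac)
  qed
qed

lemma sums_nat_mult_power:
  fixes x :: real
  assumes "\<bar>x\<bar> < 1"
  shows "(\<lambda>k. real k * x ^ k) sums (x / (1 - x)\<^sup>2)"
proof -
  have "(\<lambda>k. x * (of_nat (Suc k) * x ^ k)) sums (x * (1 / (1 - x)\<^sup>2))"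
    using assms by (intro sums_mult geometric_deriv_sums) auto
  hence "(\<lambda>k. real (Suc k) * x ^ Suc k) sums (x / (1 - x)\<^sup>2)"
    by (simp add: mult_ac)
  thus ?thesis by (subst (asm) sums_Suc_iff) simp
qed

text \<open>Bounding every coefficient by \<open>bounded_coeff_le\<close> leaves the series of
  \<open>sums_nat_mult_power\<close> at \<open>r\<^sup>2\<close>.\<close>

lemma bounded_area_sum_le:
  fixes F :: "complex \<Rightarrow> complex"
  assumes F: "\<And>z. norm z < 1 \<Longrightarrow> (\<lambda>k. c k * z ^ k) sums F z"
    and bd: "\<And>z. norm z < 1 \<Longrightarrow> norm (F z) \<le> 1" and r: "0 \<le> r" "r < 1"
  shows "summable (\<lambda>k. real k * (norm (c k))\<^sup>2 * r ^ (2 * k))"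
    and "(\<Sum>k. real k * (norm (c k))\<^sup>2 * r ^ (2 * k)) \<le> (1 - (norm (c 0))\<^sup>2)\<^sup>2 * r\<^sup>2 / (1 - r\<^sup>2)\<^sup>2"
proof -
  let ?A = "1 - (norm (c 0))\<^sup>2"
  have le: "real k * (norm (c k))\<^sup>2 * r ^ (2 * k) \<le> ?A\<^sup>2 * (real k * (r\<^sup>2) ^ k)" for k
  proof (cases "k = 0")
    case False
    hence "(norm (c k))\<^sup>2 \<le> ?A\<^sup>2"
      by (intro power_mono bounded_coeff_le[OF F bd]) auto
    hence "(real k * r ^ (2 * k)) * (norm (c k))\<^sup>2 \<le> (real k * r ^ (2 * k)) * ?A\<^sup>2"
      using r by (intro mult_left_mono) auto
    thus ?thesis unfolding power_mult[of r 2 k] by (simp only: mult_ac)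
  qed simp
  have g: "(\<lambda>k. ?A\<^sup>2 * (real k * (r\<^sup>2) ^ k)) sums (?A\<^sup>2 * (r\<^sup>2 / (1 - r\<^sup>2)\<^sup>2))"
    using r by (intro sums_mult sums_nat_mult_power) (auto simp: power_less_one_iff)
  show s: "summable (\<lambda>k. real k * (norm (c k))\<^sup>2 * r ^ (2 * k))"
    by (rule summable_comparison_test'[OF sums_summable[OF g], of 0]) (use le r in auto)
  from suminf_le[OF le s sums_summable[OF g]] sums_unique[OF g]
  show "(\<Sum>k. real k * (norm (c k))\<^sup>2 * r ^ (2 * k)) \<le> ?A\<^sup>2 * r\<^sup>2 / (1 - r\<^sup>2)\<^sup>2"
    by simp
qed

section \<open>The real inequality at the critical radius\<close>

text \<open>For \<open>a > r\<close>, the first-order term in \<open>1 - a\<close> cancels because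
  \<open>r\<^sup>2 + 4 * r = 1\<close>; the slack of the first two terms and the area term then
  share the factor \<open>(1 - a)\<^sup>2\<close>, and only the cofactors are compared. For
  \<open>a \<le> r\<close>, numerical bounds suffice.\<close>

lemma bohr_extremal_inequality:
  fixes a r :: real
  assumes r: "0 < r" "r\<^sup>2 + 4 * r = 1" and a: "0 \<le> a" "a \<le> 1"
    and S: "S \<le> r * (1 - a\<^sup>2) / (1 - r)" "r < a \<Longrightarrow> S \<le> r * (1 - a\<^sup>2) / (1 - r * a)"
  shows "(a + r) / (1 + a * r) + S + 2 * (1 + r) * ((1 - a\<^sup>2)\<^sup>2 * r\<^sup>2 / (1 - r\<^sup>2)\<^sup>2) \<le> 1"
proof -
  \<comment> \<open>A rational slightly above the root \<open>sqrt 5 - 2\<close>.\<close>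
  have r4: "r < 6/25"
  proof (rule ccontr)
    assume "\<not> r < 6/25"
    hence "(6/25)\<^sup>2 \<le> r\<^sup>2" by (intro power_mono) auto
    with \<open>\<not> r < 6/25\<close> r(2) show False by (simp add: power2_eq_square)
  qed
  have r2: "1 - r\<^sup>2 = 4 * r" using r by simp
  have area: "2 * (1 + r) * ((1 - a\<^sup>2)\<^sup>2 * r\<^sup>2 / (1 - r\<^sup>2)\<^sup>2) = (1 + r) * (1 - a\<^sup>2)\<^sup>2 / 8"
    unfolding r2 using r(1) by (simp add: field_simps power2_eq_square)
  have a2: "0 \<le> 1 - a\<^sup>2" using a by (simp add: power_le_one)
  show ?thesis
  proof (cases "r < a")
    case False
    have "(a + r) / (1 + a * r) \<le> a + r"
    proof -
      have "0 \<le> a * r" using a r by simp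
      moreover have "(a + r) * 1 \<le> (a + r) * (1 + a * r)"
        using a r by (intro mult_left_mono) auto
      ultimately show ?thesis by (simp add: divide_le_eq)
    qed
    moreover have "S \<le> 1/3"
    proof (rule order_trans[OF S(1)])
      have "r * (1 - a\<^sup>2) \<le> r * 1" using r by (intro mult_left_mono) auto
      thus "r * (1 - a\<^sup>2) / (1 - r) \<le> 1/3" using r4 by (simp add: divide_le_eq)
    qed
    moreover have "(1 + r) * (1 - a\<^sup>2)\<^sup>2 / 8 \<le> (1 + r) * 1 / 8"
      using a2 r by (intro divide_right_mono mult_left_mono power_le_one) auto
    \<comment> \<open>The total stays below 12/25 + 1/3 + 31/200, which is less than 1.\<close>
    moreover have "u + S + v \<le> 1" if "u \<le> a + r" "S \<le> 1/3" "v \<le> (1 + r) * 1 / 8" for u v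
      using that False r4 by simp
    ultimately show ?thesis unfolding area by blast
  next
    case True
    have ar: "0 \<le> a * r" "a * r < 1"
    proof -
      show "0 \<le> a * r" using a r by simp
      have "a * r \<le> 1 * r" using a r by (intro mult_right_mono) auto
      thus "a * r < 1" using r4 by linarith
    qed
    have d: "1 - a\<^sup>2 * r\<^sup>2 = (1 + a * r) * (1 - a * r)" "1 - a\<^sup>2 * r\<^sup>2 > 0"
    proof -
      show eq: "1 - a\<^sup>2 * r\<^sup>2 = (1 + a * r) * (1 - a * r)"
        by (simp add: algebra_simps power2_eq_square)
      show "1 - a\<^sup>2 * r\<^sup>2 > 0" unfolding eq using ar by (intro mult_pos_pos) auto
    qed
    have num: "(1 - a) * (1 - r) * (1 - a * r) - r * (1 - a\<^sup>2) * (1 + a * r)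
        = (1 - a)\<^sup>2 * r * (2 + r * (1 + a)) + (1 - a) * (1 - 4 * r - r\<^sup>2)"
      by (simp add: algebra_simps power2_eq_square)
    have "1 - (a + r) / (1 + a * r) - r * (1 - a\<^sup>2) / (1 - r * a)
        = ((1 - a) * (1 - r) * (1 - a * r) - r * (1 - a\<^sup>2) * (1 + a * r)) / (1 - a\<^sup>2 * r\<^sup>2)"
      unfolding d(1) using ar by (simp add: divide_simps) (simp add: algebra_simps)
    also have "\<dots> = (1 - a)\<^sup>2 * r * (2 + r * (1 + a)) / (1 - a\<^sup>2 * r\<^sup>2)"
      unfolding num using r by simp
    finally have eq: "1 - (a + r) / (1 + a * r) - r * (1 - a\<^sup>2) / (1 - r * a)
        = (1 - a)\<^sup>2 * r * (2 + r * (1 + a)) / (1 - a\<^sup>2 * r\<^sup>2)" .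
    \<comment> \<open>Replace \<open>(1 + a)\<^sup>2\<close> by \<open>2 (1 + a)\<close> and the remaining concave cubic by its tangent at \<open>a = 1\<close>.\<close>
    have key: "(1 + r) * (1 + a)\<^sup>2 * (1 - a\<^sup>2 * r\<^sup>2) \<le> 8 * r * (2 + r * (1 + a))"
    proof -
      have "(1 + a)\<^sup>2 \<le> 2 * (1 + a)"
        using a mult_right_mono[of "1 + a" 2 "1 + a"] by (simp add: power2_eq_square)
      hence "(1 + r) * (1 + a)\<^sup>2 * (1 - a\<^sup>2 * r\<^sup>2) \<le> (1 + r) * (2 * (1 + a)) * (1 - a\<^sup>2 * r\<^sup>2)"
        using r d(2) by (intro mult_left_mono mult_right_mono) auto
      also have "\<dots> = 2 * (1 + r) * ((1 + a) * (1 - a\<^sup>2 * r\<^sup>2))" by (simp only: mult_ac)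
      also have "\<dots> \<le> 2 * (1 + r) * (8 * r - (1 - 5 * r\<^sup>2) * (1 - a))"
      proof (intro mult_left_mono)
        \<comment> \<open>The tangent has value \<open>2 * (1 - r\<^sup>2)\<close>, which is
          \<open>8 * r\<close>, and slope \<open>1 - 5 * r\<^sup>2\<close> at \<open>a = 1\<close>;
          hence the double zero of the difference.\<close>
        have "2 * (1 - r\<^sup>2) - (1 - 5 * r\<^sup>2) * (1 - a) - (1 + a) * (1 - a\<^sup>2 * r\<^sup>2)
            = r\<^sup>2 * (1 - a)\<^sup>2 * (a + 3)"
          by (simp add: algebra_simps power2_eq_square)
        moreover have "0 \<le> r\<^sup>2 * (1 - a)\<^sup>2 * (a + 3)" using a by simp
        ultimately show "(1 + a) * (1 - a\<^sup>2 * r\<^sup>2) \<le> 8 * r - (1 - 5 * r\<^sup>2) * (1 - a)"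
          unfolding r2 by linarith
      qed (use r in auto)
      also have "\<dots> \<le> 16 * r * (1 + r) - 8 * r\<^sup>2 * (1 - a)"
      proof -
        \<comment> \<open>Both sides are affine in \<open>1 - a\<close> with the same constant term,
          so comparing slopes is enough.\<close>
        have "r\<^sup>2 \<le> (6/25)\<^sup>2" using r r4 by (intro power_mono) auto
        hence r2': "r\<^sup>2 \<le> 1/17" by (simp add: power2_eq_square)
        have "8 * r\<^sup>2 \<le> 2 * (1 * (1 - 5 * r\<^sup>2))" using r2' by simp
        also have "\<dots> \<le> 2 * ((1 + r) * (1 - 5 * r\<^sup>2))"
          using r r2' by (intro mult_left_mono mult_right_mono) auto
        finally have "8 * r\<^sup>2 * (1 - a) \<le> 2 * ((1 + r) * (1 - 5 * r\<^sup>2)) * (1 - a)"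
          using a by (intro mult_right_mono) auto
        moreover have "2 * (1 + r) * (8 * r - (1 - 5 * r\<^sup>2) * (1 - a))
            = 16 * r * (1 + r) - 2 * ((1 + r) * (1 - 5 * r\<^sup>2)) * (1 - a)"
          by (simp add: algebra_simps)
        ultimately show ?thesis by simp
      qed
      also have "\<dots> = 8 * r * (2 + r * (1 + a))" by (simp add: algebra_simps power2_eq_square)
      finally show ?thesis .
    qed
    have "(1 - a)\<^sup>2 * ((1 + r) * (1 + a)\<^sup>2 * (1 - a\<^sup>2 * r\<^sup>2)) \<le> (1 - a)\<^sup>2 * (8 * r * (2 + r * (1 + a)))"
      by (intro mult_left_mono key) auto
    moreover have "(1 - a\<^sup>2)\<^sup>2 = (1 - a)\<^sup>2 * (1 + a)\<^sup>2"
      by (simp add: algebra_simps power2_eq_square)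
    ultimately have "(1 + r) * (1 - a\<^sup>2)\<^sup>2 / 8 \<le> (1 - a)\<^sup>2 * r * (2 + r * (1 + a)) / (1 - a\<^sup>2 * r\<^sup>2)"
      using d(2) by (simp add: pos_le_divide_eq algebra_simps)
    thus ?thesis using S(2)[OF True] eq unfolding area by linarith
  qed
qed

section \<open>The inequality at the sharp constants\<close>

lemma taylor_coeff_sums:
  assumes "f holomorphic_on ball 0 1" "norm z < 1"
  shows "(\<lambda>k. taylor_coeff f k * z ^ k) sums f z"
  using holomorphic_power_series[OF assms(1), of z] assms(2)
  by (simp add: taylor_coeff_def fps_expansion_def)

lemma taylor_coeff_eqI:
  assumes "\<And>z. norm z < 1 \<Longrightarrow> (\<lambda>k. c k * z ^ k) sums f z"
  shows "taylor_coeff f k = c k"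
proof -
  have "f has_fps_expansion Abs_fps c"
    by (rule has_fps_expansionI, rule eventually_mono[OF eventually_nhds_ball[of 1]]) (use assms in auto)
  thus ?thesis
    unfolding taylor_coeff_def by (subst fps_expansion_eqI) auto
qed

text \<open>Each of the three bounds grows with the radius, so \<open>s\<close> is replaced by
  \<open>r\<close> before \<open>bohr_extremal_inequality\<close> is applied.\<close>

lemma bohr_area_inequality_sharp_radius:
  fixes r :: real
  assumes r: "0 < r" "r\<^sup>2 + 4 * r = 1"
  shows "bohr_area_inequality r (2 * (1 + r))"
  unfolding bohr_area_inequality_def
proof (intro allI impI ballI)
  fix f :: "complex \<Rightarrow> complex" and z :: complex and s :: real
  assume "f holomorphic_on ball 0 1 \<and> (\<forall>z\<in>ball 0 1. norm (f z) \<le> 1)"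
  hence hol: "f holomorphic_on ball 0 1" and bd: "\<And>z. norm z < 1 \<Longrightarrow> norm (f z) \<le> 1"
    by auto
  assume "z \<in> ball 0 1" "norm z = s \<and> s \<le> r"
  hence s: "0 \<le> s" "s \<le> r" "norm z = s" "norm z < 1" by auto
  have r1: "r < 1" using r by (smt (verit) zero_le_power2)
  note F = taylor_coeff_sums[OF hol]
  let ?c = "taylor_coeff f"
  let ?a = "norm (?c 0)"
  have F0: "f 0 = ?c 0"
    by (simp add: taylor_coeff_def fps_expansion_def)
  have a: "0 \<le> ?a" "?a \<le> 1" using bd[of 0] F0 by auto
  have T1: "norm (f z) \<le> (?a + r) / (1 + ?a * r)"
  proof -
    have "norm (f z) \<le> (?a + s) / (1 + ?a * s)"
      using schwarz_pick_norm[OF hol bd s(4)] s(3) F0 by simp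
    also have "\<dots> \<le> (?a + r) / (1 + ?a * r)"
    proof -
      \<comment> \<open>This product is the difference of the two sides after
        cross-multiplication.\<close>
      have "0 \<le> (r - s) * (1 - ?a\<^sup>2)" using s a by (simp add: power_le_one)
      hence "(?a + s) * (1 + ?a * r) \<le> (?a + r) * (1 + ?a * s)"
        by (simp add: algebra_simps power2_eq_square)
      moreover have "0 < 1 + ?a * s" "0 < 1 + ?a * r"
        using a r s by (auto intro!: add_pos_nonneg)
      ultimately show ?thesis by (simp add: pos_divide_le_eq pos_le_divide_eq)
    qed
    finally show ?thesis .
  qed
  have T2: "(\<Sum>k. norm (?c (Suc k)) * s ^ Suc k) \<le> (\<Sum>k. norm (?c (Suc k)) * r ^ Suc k)"
    by (intro suminf_le mult_left_mono power_mono bounded_coeff_abs_summable[OF F bd]) (use s r r1 in auto)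
  have T3: "image_area f s / pi \<le> (1 - ?a\<^sup>2)\<^sup>2 * r\<^sup>2 / (1 - r\<^sup>2)\<^sup>2"
  proof -
    have "image_area f s / pi = (\<Sum>k. real k * (norm (?c k))\<^sup>2 * s ^ (2 * k))"
      by (simp add: image_area_def)
    also have "\<dots> \<le> (\<Sum>k. real k * (norm (?c k))\<^sup>2 * r ^ (2 * k))"
      by (intro suminf_le mult_left_mono power_mono bounded_area_sum_le[OF F bd]) (use s r r1 in auto)
    also have "\<dots> \<le> (1 - ?a\<^sup>2)\<^sup>2 * r\<^sup>2 / (1 - r\<^sup>2)\<^sup>2"
      by (intro bounded_area_sum_le[OF F bd]) (use r r1 in auto)
    finally show ?thesis .
  qed
  have "norm (f z) + (\<Sum>k. norm (?c (Suc k)) * s ^ Suc k) + 2 * (1 + r) * (image_area f s / pi)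
      \<le> (?a + r) / (1 + ?a * r) + (\<Sum>k. norm (?c (Suc k)) * r ^ Suc k)
        + 2 * (1 + r) * ((1 - ?a\<^sup>2)\<^sup>2 * r\<^sup>2 / (1 - r\<^sup>2)\<^sup>2)"
    using r by (intro add_mono mult_left_mono T1 T2 T3) auto
  also have "\<dots> \<le> 1"
    by (intro bohr_extremal_inequality r a bounded_coeff_abs_summable(2)[OF F bd]
          bounded_coeff_abs_sum_le[OF F bd]) (use r r1 in auto)
  finally show "norm (f z) + (\<Sum>k. norm (?c (Suc k)) * s ^ Suc k) + 2 * (1 + r) * (image_area f s / pi) \<le> 1" .
qed

section \<open>Sharpness of both constants\<close>

text \<open>The test function \<open>(a + z) / (1 + a * z)\<close> at \<open>z = r\<close>, where
  all three terms have closed forms. Both sharpness claims reduce to this real inequality.\<close>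

lemma bohr_area_inequality_moebius:
  assumes B: "bohr_area_inequality R q" and a: "0 < a" "a < 1" and r: "0 \<le> r" "r < 1" "r \<le> R"
  shows "(a + r) / (1 + a * r) + r * (1 - a\<^sup>2) / (1 - r * a)
           + q * ((1 - a\<^sup>2)\<^sup>2 * r\<^sup>2 / (1 - a\<^sup>2 * r\<^sup>2)\<^sup>2) \<le> 1"
proof -
  define A where "A = 1 - a\<^sup>2"
  have A: "A > 0" using a by (simp add: A_def power_less_one_iff)
  define f where "f z = (of_real a + z) / (1 + of_real a * z)" for z :: complex
  define c :: "nat \<Rightarrow> complex"
    where "c k = (if k = 0 then of_real a else of_real A * (- of_real a) ^ (k - 1))" for k
  have az: "norm (of_real a * z) < 1" if "norm z < 1" for z :: complex
    using mult_strict_mono'[of a 1 "norm z" 1] a that by (simp add: norm_mult)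
  have ne: "1 + of_real a * z \<noteq> 0" if "norm z < 1" for z :: complex
    using az[OF that] by (metis add_eq_0_iff norm_minus_cancel norm_one less_irrefl)
  have hol: "f holomorphic_on ball 0 1"
    unfolding f_def by (intro holomorphic_intros) (use ne in auto)
  have bd: "norm (f z) \<le> 1" if "norm z < 1" for z
  proof -
    have "(norm (1 + of_real a * z))\<^sup>2 - (norm (of_real a + z))\<^sup>2 = A * (1 - (norm z)\<^sup>2)"
      unfolding cmod_power2 A_def by (simp add: algebra_simps power2_eq_square)
    moreover have "0 \<le> A * (1 - (norm z)\<^sup>2)"
      using A that by (intro mult_nonneg_nonneg) (auto simp: power_le_one)
    ultimately have "(norm (of_real a + z))\<^sup>2 \<le> (norm (1 + of_real a * z))\<^sup>2" by linarith
    hence "norm (of_real a + z) \<le> norm (1 + of_real a * z)"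
      by (rule power2_le_imp_le) simp
    thus ?thesis using ne[OF that] by (simp add: f_def norm_divide)
  qed
  have coeff: "taylor_coeff f k = c k" for k
  proof (rule taylor_coeff_eqI)
    fix z :: complex assume z: "norm z < 1"
    \<comment> \<open>Geometric expansion of \<open>f z = a + A * z / (1 + a * z)\<close>; the
      constant \<open>a\<close> is added as the term at index 0.\<close>
    have "(\<lambda>k. of_real A * z * (- (of_real a * z)) ^ k) sums (of_real A * z * (1 / (1 - - (of_real a * z))))"
      by (intro sums_mult geometric_sums) (use az[OF z] in simp)
    also have "(\<lambda>k. of_real A * z * (- (of_real a * z)) ^ k) = (\<lambda>k. c (Suc k) * z ^ Suc k)"
      unfolding mult_minus_left[symmetric] power_mult_distrib by (simp add: c_def fun_eq_iff)
    finally have "(\<lambda>k. c k * z ^ k) sums (of_real A * z * (1 / (1 - - (of_real a * z))) + of_real a)"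
      by (subst (asm) sums_Suc_iff) (simp add: c_def)
    also have "of_real A * z * (1 / (1 - - (of_real a * z))) + of_real a = f z"
      using ne[OF z] unfolding f_def A_def
      by (simp add: divide_simps) (simp add: algebra_simps power2_eq_square)
    finally show "(\<lambda>k. c k * z ^ k) sums f z" .
  qed
  have nc: "norm (c (Suc k)) = A * a ^ k" for k
    using A a by (simp add: c_def norm_mult norm_power)
  have ar: "a * r < 1" "0 \<le> a * r"
    using mult_strict_mono'[of a 1 r 1] a r by auto
  have S: "(\<Sum>k. norm (taylor_coeff f (Suc k)) * r ^ Suc k) = r * A / (1 - r * a)"
  proof -
    have "(\<lambda>k. A * r * (a * r) ^ k) sums (A * r * (1 / (1 - a * r)))"
      using ar by (intro sums_mult geometric_sums) auto
    also have "(\<lambda>k. A * r * (a * r) ^ k) = (\<lambda>k. norm (taylor_coeff f (Suc k)) * r ^ Suc k)"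
      by (simp add: coeff nc power_mult_distrib fun_eq_iff)
    finally show ?thesis by (simp add: sums_iff mult_ac)
  qed
  have I: "image_area f r / pi = A\<^sup>2 * r\<^sup>2 / (1 - a\<^sup>2 * r\<^sup>2)\<^sup>2"
  proof -
    have "(\<lambda>k. A\<^sup>2 * r\<^sup>2 * (of_nat (Suc k) * ((a * r)\<^sup>2) ^ k)) sums (A\<^sup>2 * r\<^sup>2 * (1 / (1 - (a * r)\<^sup>2)\<^sup>2))"
      using ar by (intro sums_mult geometric_deriv_sums) (simp add: abs_square_less_1)
    also have "(\<lambda>k. A\<^sup>2 * r\<^sup>2 * (of_nat (Suc k) * ((a * r)\<^sup>2) ^ k)) =
        (\<lambda>k. real (Suc k) * (norm (taylor_coeff f (Suc k)))\<^sup>2 * r ^ (2 * Suc k))"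
    proof
      fix k
      have "(a ^ k)\<^sup>2 = (a\<^sup>2) ^ k" by (simp only: power_mult[symmetric] mult.commute)
      thus "A\<^sup>2 * r\<^sup>2 * (of_nat (Suc k) * ((a * r)\<^sup>2) ^ k) =
          real (Suc k) * (norm (taylor_coeff f (Suc k)))\<^sup>2 * r ^ (2 * Suc k)"
        unfolding coeff nc power_mult[of r 2 "Suc k"] power_Suc power_mult_distrib
        by (simp only: mult_ac of_nat_Suc)
    qed
    finally have "(\<lambda>k. real k * (norm (taylor_coeff f k))\<^sup>2 * r ^ (2 * k)) sums (A\<^sup>2 * r\<^sup>2 * (1 / (1 - (a * r)\<^sup>2)\<^sup>2))"
      by (subst (asm) sums_Suc_iff) simp
    thus ?thesis by (simp add: image_area_def sums_iff power_mult_distrib)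
  qed
  have "norm (f (of_real r)) = (a + r) / (1 + a * r)"
  proof -
    have "f (of_real r) = of_real ((a + r) / (1 + a * r))" by (simp add: f_def)
    thus ?thesis using a r by (simp only: norm_of_real) simp
  qed
  moreover have "norm (f (of_real r)) + (\<Sum>k. norm (taylor_coeff f (Suc k)) * r ^ Suc k)
      + q * (image_area f r / pi) \<le> 1"
    using B[unfolded bohr_area_inequality_def, rule_format, of f "of_real r" r] hol bd r by auto
  ultimately show ?thesis unfolding S I by (simp add: A_def)
qed

text \<open>Beyond the root the coefficient of \<open>1 - a\<close> in the first two terms is
  positive, so they exceed 1 for \<open>a\<close> near 1; a nonnegative area term cannot
  compensate.\<close>

lemma not_bohr_area_inequality_larger_radius:
  fixes r\<^sub>0 R q :: real
  assumes r0: "0 < r\<^sub>0" "r\<^sub>0\<^sup>2 + 4 * r\<^sub>0 = 1" and R: "r\<^sub>0 < R" and q: "0 \<le> q"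
  shows "\<not> bohr_area_inequality R q"
proof
  assume B: "bohr_area_inequality R q"
  have "r\<^sub>0 < 1" using r0 by (smt (verit) zero_le_power2)
  \<comment> \<open>The test point must lie in the disk even if \<open>R\<close> is large.\<close>
  with R obtain r where r: "r\<^sub>0 < r" "r < min R 1"
    using dense[of r\<^sub>0 "min R 1"] by auto
  define e where "e = r\<^sup>2 + 4 * r - 1"
  have "r\<^sub>0\<^sup>2 < r\<^sup>2" using r r0 by (intro power_strict_mono) auto
  hence e0: "e > 0" using r r0 by (simp add: e_def)
  have r2: "r\<^sup>2 < 1" using r r0 by (simp add: power_less_one_iff)
  \<comment> \<open>The correction below is at most \<open>4 * d\<close>, half of \<open>e\<close>;
    as \<open>e < 4\<close>, also \<open>a > 0\<close>.\<close>
  define d where "d = e / 8"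
  define a where "a = 1 - d"
  have a: "0 < a" "a < 1" using e0 r r2 by (auto simp: a_def d_def e_def)
  have ar: "0 \<le> a * r" "a * r < 1"
    using mult_strict_mono'[of a 1 r 1] a r r0 by auto
  have dn: "1 - a\<^sup>2 * r\<^sup>2 = (1 + a * r) * (1 - a * r)"
    by (simp add: algebra_simps power2_eq_square)
  have "(a + r) / (1 + a * r) + r * (1 - a\<^sup>2) / (1 - r * a) - 1
      = (1 - a) * (r * (1 + a) * (1 + a * r) - (1 - r) * (1 - a * r)) / ((1 + a * r) * (1 - a * r))"
    using ar by (simp add: divide_simps) (simp add: algebra_simps power2_eq_square)
  also have "r * (1 + a) * (1 + a * r) - (1 - r) * (1 - a * r) = e - d * (2 * r + (1 + a) * r\<^sup>2)"
    by (simp add: e_def a_def algebra_simps power2_eq_square)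
  also have "(1 - a) * (e - d * (2 * r + (1 + a) * r\<^sup>2)) / ((1 + a * r) * (1 - a * r)) > 0"
  proof (intro divide_pos_pos mult_pos_pos)
    have "(1 + a) * r\<^sup>2 \<le> 2 * 1" using a r2 by (intro mult_mono) auto
    hence "d * (2 * r + (1 + a) * r\<^sup>2) \<le> d * 4" using r e0 by (intro mult_left_mono) (auto simp: d_def)
    thus "0 < e - d * (2 * r + (1 + a) * r\<^sup>2)" using e0 by (simp add: d_def)
  qed (use a ar in auto)
  finally have "(a + r) / (1 + a * r) + r * (1 - a\<^sup>2) / (1 - r * a) > 1" by simp
  moreover have "q * ((1 - a\<^sup>2)\<^sup>2 * r\<^sup>2 / (1 - a\<^sup>2 * r\<^sup>2)\<^sup>2) \<ge> 0" using q by simp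
  ultimately show False
    using bohr_area_inequality_moebius[OF B a, of r] r r0 by auto
qed

text \<open>At the critical radius the first-order term vanishes, so the comparison takes place at
  order \<open>d\<^sup>2\<close>; its limit as \<open>d\<close> tends to 0 is exactly
  \<open>2 * (1 + r) < q\<close>.\<close>

lemma not_bohr_area_inequality_larger_factor:
  fixes r q :: real
  assumes r: "0 < r" "r\<^sup>2 + 4 * r = 1" and q: "2 * (1 + r) < q"
  shows "\<not> bohr_area_inequality r q"
proof
  assume B: "bohr_area_inequality r q"
  have "0 < r\<^sup>2" using r by simp
  hence r1: "r < 1/4" using r(2) by linarith
  have r2: "1 - r\<^sup>2 = 4 * r" using r by simp
  define e where "e = q - 2 * (1 + r)"
  \<comment> \<open>Chosen so that the error \<open>r * (1 + r) * d + q * d\<close> stays below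
    \<open>d * (q + 1) = e\<close>.\<close>
  define d where "d = e / (q + 1)"
  define a where "a = 1 - d"
  have e0: "e > 0" using q by (simp add: e_def)
  have d: "0 < d" "d < 1" using r q by (auto simp: d_def e_def)
  have a: "0 < a" "a < 1" using d by (auto simp: a_def)
  have ar: "0 \<le> a * r" "a * r < 1"
    using mult_strict_mono'[of a 1 r 1] a r r1 by auto
  define D where "D = 1 - a\<^sup>2 * r\<^sup>2"
  have D: "D = (1 + a * r) * (1 - a * r)" "D > 0"
  proof -
    show eq: "D = (1 + a * r) * (1 - a * r)"
      by (simp add: D_def algebra_simps power2_eq_square)
    show "D > 0" unfolding eq using ar by (intro mult_pos_pos) auto
  qed
  have "(a + r) / (1 + a * r) + r * (1 - a\<^sup>2) / (1 - r * a) - 1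
      = (1 - a) * (r * (1 + a) * (1 + a * r) - (1 - r) * (1 - a * r)) / D"
    unfolding D using ar by (simp add: divide_simps) (simp add: algebra_simps power2_eq_square)
  also have "r * (1 + a) * (1 + a * r) - (1 - r) * (1 - a * r)
      = (r\<^sup>2 + 4 * r - 1) - d * r * (2 + r * (1 + a))"
    by (simp add: a_def algebra_simps power2_eq_square)
  also have "\<dots> = - (d * r * (2 + r * (1 + a)))" using r by simp
  finally have lin: "(a + r) / (1 + a * r) + r * (1 - a\<^sup>2) / (1 - r * a)
      = 1 - d\<^sup>2 * r * (2 + r * (1 + a)) / D"
    by (simp add: a_def power2_eq_square mult_ac)
  have quad: "(1 - a\<^sup>2)\<^sup>2 * r\<^sup>2 / D\<^sup>2 = d\<^sup>2 * r * (r * (1 + a)\<^sup>2 / D) / D"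
    by (simp add: a_def power2_eq_square algebra_simps)
  have "(2 + r * (1 + a)) * D < q * (r * (1 + a)\<^sup>2)"
  proof -
    have "(2 + r * (1 + a)) * D \<le> (2 + 2 * r) * (4 * r + 2 * r\<^sup>2 * d)"
    proof (intro mult_mono)
      show "2 + r * (1 + a) \<le> 2 + 2 * r"
        using a r mult_left_mono[of "1 + a" 2 r] by simp
      have "4 * r + 2 * r\<^sup>2 * d - D = (4 * r + r\<^sup>2 - 1) + r\<^sup>2 * d\<^sup>2"
        by (simp add: D_def a_def algebra_simps power2_eq_square)
      moreover have "0 \<le> r\<^sup>2 * d\<^sup>2" by simp
      ultimately show "D \<le> 4 * r + 2 * r\<^sup>2 * d" using r(2) by linarith
    qed (use a r d D in auto)
    also have "\<dots> = 4 * r * (2 * (1 + r) + r * (1 + r) * d)"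
      by (simp add: algebra_simps power2_eq_square)
    also have "\<dots> < 4 * r * (q * (1 - d))"
    proof (intro mult_strict_left_mono)
      have "r * (1 + r) < 1" using r r1 by (simp add: algebra_simps power2_eq_square)
      hence "r * (1 + r) * d < 1 * d" using d by (intro mult_strict_right_mono)
      hence "r * (1 + r) * d + q * d < d * (q + 1)" by (simp add: algebra_simps)
      also have "\<dots> = e" using q r by (simp add: d_def)
      finally show "2 * (1 + r) + r * (1 + r) * d < q * (1 - d)"
        by (simp add: e_def algebra_simps)
    qed (use r in auto)
    also have "\<dots> \<le> q * (r * (1 + a)\<^sup>2)"
    proof -
      \<comment> \<open>With \<open>1 + a = 2 - d\<close>, its square is
        \<open>4 * (1 - d) + d\<^sup>2\<close>.\<close>
      have "q * (r * (1 + a)\<^sup>2) - 4 * r * (q * (1 - d)) = q * r * d\<^sup>2"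
        by (simp add: a_def algebra_simps power2_eq_square)
      moreover have "q * r * d\<^sup>2 \<ge> 0" using q r by simp
      ultimately show ?thesis by linarith
    qed
    finally show ?thesis .
  qed
  hence "2 + r * (1 + a) < q * (r * (1 + a)\<^sup>2 / D)"
    using D(2) by (simp add: pos_less_divide_eq)
  hence "d\<^sup>2 * r / D * (2 + r * (1 + a)) < d\<^sup>2 * r / D * (q * (r * (1 + a)\<^sup>2 / D))"
    using d r D(2) by (intro mult_strict_left_mono) auto
  hence "d\<^sup>2 * r * (2 + r * (1 + a)) / D < q * ((1 - a\<^sup>2)\<^sup>2 * r\<^sup>2 / D\<^sup>2)"
    unfolding quad by (simp add: mult_ac)
  thus False
    using bohr_area_inequality_moebius[OF B a, of r] r r1 unfolding lin D_def[symmetric] by auto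
qed

theorem theorem3:
  fixes r\<^sub>0 p :: real
  defines "r\<^sub>0 \<equiv> sqrt 5 - 2" and "p \<equiv> 2 * (sqrt 5 - 1)"
  shows "bohr_area_inequality r\<^sub>0 p \<and>
         (\<forall>R>r\<^sub>0. \<not> bohr_area_inequality R p) \<and>
         (\<forall>q>p. \<not> bohr_area_inequality r\<^sub>0 q)"
proof -
  have "2 < sqrt 5" by (rule real_less_rsqrt) simp
  hence r: "0 < r\<^sub>0" by (simp add: r\<^sub>0_def)
  have r2: "r\<^sub>0\<^sup>2 + 4 * r\<^sub>0 = 1" by (simp add: r\<^sub>0_def power2_eq_square algebra_simps)
  have p: "p = 2 * (1 + r\<^sub>0)" by (simp add: r\<^sub>0_def p_def)
  show ?thesis
    unfolding p
    using bohr_area_inequality_sharp_radius[OF r r2] r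
      not_bohr_area_inequality_larger_radius[OF r r2, of _ "2 * (1 + r\<^sub>0)"]
      not_bohr_area_inequality_larger_factor[OF r r2]
    by auto
qed

end
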